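(* Let $f:\mathbb{R}^n\to\mathbb{R}$ be an $L$-smooth function satisfying $\arg\min f\neq\emptyset$, and let $h>0$. Then, for any $x_k\in\mathbb{R}^n$, there exists an $\eta_k\in\mathbb{R}$ that satisfies $F_h(\eta_k;x_k)=0$ and $$\eta_k\ \geq\ \eta_{\mathrm{LB}}:=\left(1+\frac{Lh}{2}\right)^{-1}>0.$$
   Context: A function $f$ is $L$-smooth ($L>0$) if it is differentiable and $\nabla f$ is Lipschitz continuous with constant $L$. For $h>0$, $\eta\in\mathbb{R}$ and $x\in\mathbb{R}^n$, define $$F_h(\eta;x)=f(x-\eta h\nabla f(x))-f(x)+h\eta^2\|\nabla f(x)\|^2,$$ where $\|\cdot\|$ is the Euclidean norm. *)

theory Defs
  imports "HOL-Analysis.Analysis"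
begin

text \<open>The definite description is meaningful only where \<open>f\<close> is differentiable; there, the
  vector is unique by \<open>GDERIV_gradient_iff\<close> below.\<close>

definition gradient :: "(real ^ 'n \<Rightarrow> real) \<Rightarrow> real ^ 'n \<Rightarrow> real ^ 'n" where
  "gradient f x = (THE g. GDERIV f x :> g)"

lemma GDERIV_gradient_iff:
  assumes "f differentiable (at x)"
  shows "GDERIV f x :> g \<longleftrightarrow> g = gradient f x"
proof -
  obtain D where D: "(f has_derivative D) (at x)"
    using assms by (auto simp: differentiable_def)
  have lin: "linear D"
    using D has_derivative_linear by blast
  define g0 where "g0 = adjoint D 1"
  have D_eq: "D = (\<lambda>h. h \<bullet> g0)"
  proof
    show "D h = h \<bullet> g0" for h
      using adjoint_works[OF lin, of h 1] by (simp add: g0_def)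
  qed
  have ex: "GDERIV f x :> g0"
    using D unfolding gderiv_def D_eq .
  have uniq: "a = b" if "GDERIV f x :> a" "GDERIV f x :> b" for a b
  proof -
    have "(\<lambda>h. h \<bullet> a) = (\<lambda>h. h \<bullet> b)"
      using that unfolding gderiv_def by (rule has_derivative_unique)
    then have "h \<bullet> a = h \<bullet> b" for h
      by (rule fun_cong)
    then show ?thesis
      using vector_eq_ldot[of a b] by simp
  qed
  have "GDERIV f x :> gradient f x"
    unfolding gradient_def by (rule theI, rule ex, erule uniq[OF _ ex])
  then show ?thesis
    using uniq[of g "gradient f x"] by auto
qed

definition L_smooth :: "real \<Rightarrow> (real ^ 'n \<Rightarrow> real) \<Rightarrow> bool" where
  "L_smooth L f \<longleftrightarrow>
     L > 0 \<and> (\<forall>x. f differentiable (at x)) \<and> L-lipschitz_on UNIV (gradient f)"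

definition argmin :: "('a \<Rightarrow> real) \<Rightarrow> 'a set" where
  "argmin f = {x. is_arg_min f (\<lambda>_. True) x}"

definition F :: "(real ^ 'n \<Rightarrow> real) \<Rightarrow> real \<Rightarrow> real \<Rightarrow> real ^ 'n \<Rightarrow> real" where
  "F f h \<eta> x = f (x - (\<eta> * h) *\<^sub>R gradient f x) - f x + h * \<eta>\<^sup>2 * (norm (gradient f x))\<^sup>2"

definition eta_LB :: "real \<Rightarrow> real \<Rightarrow> real" where
  "eta_LB L h = inverse (1 + L * h / 2)"

end

theory Submission
  imports Defs
begin

text \<open>The claim follows from the intermediate value theorem in \<open>\<eta>\<close>. The descent lemma gives
  \<open>F f h \<eta> x \<le> h \<eta> \<parallel>\<nabla>f x\<parallel>\<^sup>2 ((1 + L h / 2) \<eta> - 1)\<close>, so \<open>F\<close> is nonpositive at \<open>eta_LB\<close>;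
  since \<open>f\<close> is bounded below, the term quadratic in \<open>\<eta>\<close> makes \<open>F\<close> nonnegative for large \<open>\<eta>\<close>
  unless \<open>\<nabla>f x = 0\<close>, in which case \<open>F\<close> vanishes identically.\<close>

lemma L_smooth_has_derivative:
  assumes "L_smooth L f"
  shows "(f has_derivative (\<lambda>v. v \<bullet> gradient f x)) (at x)"
proof -
  have "f differentiable (at x)"
    using assms by (simp add: L_smooth_def)
  \<comment> \<open>With \<open>g\<close> chosen as \<open>gradient f x\<close> itself, the right
    side of the equivalence is reflexivity.\<close>
  then show ?thesis
    using GDERIV_gradient_iff[of f x "gradient f x"] by (simp add: gderiv_def)
qed

text \<open>Along the segment, \<open>\<phi>\<close> is \<open>f\<close> minus the varying part of
  its quadratic model. Its slope at \<open>t\<close> is nonpositive: by Cauchy-Schwarz and the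
  Lipschitz bound, the gradient change over distance \<open>t * norm d\<close> contributes at most
  \<open>L * t * (norm d)\<^sup>2\<close>.\<close>

lemma descent_lemma:
  assumes "L_smooth L f"
  shows "f (x + d) \<le> f x + d \<bullet> gradient f x + L / 2 * (norm d)\<^sup>2"
proof -
  define \<phi> where "\<phi> t = f (x + t *\<^sub>R d) - t * (d \<bullet> gradient f x) - L / 2 * t\<^sup>2 * (norm d)\<^sup>2" for t
  have "\<phi> 1 \<le> \<phi> 0"
  proof (rule DERIV_nonpos_imp_nonincreasing[of 0 1 \<phi>])
    fix t :: real
    assume "0 \<le> t" "t \<le> 1"
    let ?y = "x + t *\<^sub>R d"
    have "((\<lambda>s. f (x + s *\<^sub>R d)) has_derivative (\<lambda>s. (s *\<^sub>R d) \<bullet> gradient f ?y)) (at t)"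
      by (rule has_derivative_compose[OF _ L_smooth_has_derivative[OF assms]])
        (auto intro!: derivative_eq_intros)
    then have "((\<lambda>s. f (x + s *\<^sub>R d)) has_real_derivative d \<bullet> gradient f ?y) (at t)"
      by (simp add: has_field_derivative_def mult.commute[of _ "d \<bullet> _"])
    then have "(\<phi> has_real_derivative
        (d \<bullet> gradient f ?y - d \<bullet> gradient f x - L * t * (norm d)\<^sup>2)) (at t)"
      unfolding \<phi>_def by (auto intro!: derivative_eq_intros)
    moreover have "d \<bullet> gradient f ?y - d \<bullet> gradient f x \<le> L * t * (norm d)\<^sup>2"
    proof -
      have "d \<bullet> gradient f ?y - d \<bullet> gradient f x \<le> norm d * norm (gradient f ?y - gradient f x)"
        using norm_cauchy_schwarz by (simp flip: inner_diff_right)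
      also have "\<dots> \<le> norm d * (L * norm (?y - x))"
        using assms lipschitz_onD[of L UNIV "gradient f" ?y x]
        by (intro mult_left_mono) (simp_all add: L_smooth_def dist_norm)
      also have "\<dots> = L * t * (norm d)\<^sup>2"
        using \<open>0 \<le> t\<close> by (simp add: power2_eq_square)
      finally show ?thesis .
    qed
    ultimately show "\<exists>y. (\<phi> has_real_derivative y) (at t) \<and> y \<le> 0"
      by (metis diff_le_0_iff_le)
  qed simp
  then show ?thesis
    by (simp add: \<phi>_def)
qed

lemma continuous_on_F:
  assumes "L_smooth L f"
  shows "continuous_on S (\<lambda>\<eta>. F f h \<eta> x)"
proof -
  have "continuous_on UNIV f"
    using assms by (auto simp: L_smooth_def intro: continuous_at_imp_continuous_on
        differentiable_imp_continuous_within)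
  then show ?thesis
    unfolding F_def by (auto intro!: continuous_intros continuous_on_compose2[of UNIV f])
qed

text \<open>This explains the constant \<open>eta_LB L h\<close>: it is the root of the last
  factor.\<close>

lemma F_upper_bound:
  assumes "L_smooth L f"
  shows "F f h \<eta> x \<le> h * \<eta> * (norm (gradient f x))\<^sup>2 * ((1 + L * h / 2) * \<eta> - 1)"
  using descent_lemma[OF assms, of x "- (\<eta> * h) *\<^sub>R gradient f x"]
  by (simp add: F_def dot_square_norm power_mult_distrib) (simp add: power2_eq_square algebra_simps)

text \<open>No step can lower \<open>f\<close> by more than \<open>f x - m\<close>; from the
  threshold on, the quadratic term of \<open>F\<close> makes up for that drop.\<close>

lemma F_nonneg:
  assumes "\<And>y. m \<le> f y" "h > 0" "gradient f x \<noteq> 0"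
    and \<eta>: "\<eta> \<ge> sqrt ((f x - m) / (h * (norm (gradient f x))\<^sup>2))"
  shows "F f h \<eta> x \<ge> 0"
proof -
  have "(f x - m) / (h * (norm (gradient f x))\<^sup>2) \<le> \<eta>\<^sup>2"
    using \<eta> by (rule sqrt_le_D)
  then have "f x - m \<le> h * \<eta>\<^sup>2 * (norm (gradient f x))\<^sup>2"
    using assms(2,3) by (simp add: divide_le_eq mult_ac)
  then show ?thesis
    using assms(1)[of "x - (\<eta> * h) *\<^sub>R gradient f x"] by (simp add: F_def)
qed

theorem theorem3p5:
  fixes f :: "real ^ 'n \<Rightarrow> real" and L h :: real
  assumes "L_smooth L f"
    and "argmin f \<noteq> {}"
    and "h > 0"
  shows "\<forall>x\<^sub>k. \<exists>\<eta>\<^sub>k. F f h \<eta>\<^sub>k x\<^sub>k = 0 \<and> \<eta>\<^sub>k \<ge> eta_LB L h \<and> eta_LB L h > 0"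
proof
  fix x
  have Lh: "1 + L * h / 2 > 0"
    using assms by (simp add: L_smooth_def add_pos_pos)
  then have LB_pos: "eta_LB L h > 0"
    by (simp add: eta_LB_def)
  obtain z where z: "\<And>y. f z \<le> f y"
    using assms(2) by (auto simp: argmin_def is_arg_min_linorder)
  show "\<exists>\<eta>. F f h \<eta> x = 0 \<and> \<eta> \<ge> eta_LB L h \<and> eta_LB L h > 0"
  proof (cases "gradient f x = 0")
    case True
    then have "F f h (eta_LB L h) x = 0"
      by (simp add: F_def)
    then show ?thesis
      using LB_pos by blast
  next
    case False
    \<comment> \<open>The second entry is the threshold of \<open>F_nonneg\<close> with
      \<open>m = f z\<close>, the minimum value; the maximum keeps \<open>E\<close> to the right of
      \<open>eta_LB L h\<close>, as the intermediate value theorem requires.\<close>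
    define E where "E = max (eta_LB L h) (sqrt ((f x - f z) / (h * (norm (gradient f x))\<^sup>2)))"
    have "F f h (eta_LB L h) x \<le> 0"
      using F_upper_bound[OF assms(1), of h "eta_LB L h" x] Lh by (simp add: eta_LB_def)
    moreover have "F f h E x \<ge> 0"
      using z assms(3) False by (rule F_nonneg) (simp add: E_def)
    moreover have "eta_LB L h \<le> E"
      by (simp add: E_def)
    ultimately obtain \<eta> where "eta_LB L h \<le> \<eta>" "F f h \<eta> x = 0"
      using IVT'[of "\<lambda>\<eta>. F f h \<eta> x" "eta_LB L h" 0 E] continuous_on_F[OF assms(1)] by blast
    then show ?thesis
      using LB_pos by blast
  qed
qed

end
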